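(* There exists a constant $k>0$ such that the following holds for every Delone set $X\subset\mathbb{R}^3$. Let $(r,R)$ be the parameters of $X$ (that is, $2r=\inf_{x\neq x'\in X}|x,x'|$ and $R=\sup_{z\in\mathbb{R}^3}d(z,X)$), and let $X_6\subseteq X$ be the subset of all points $x\in X$ such that the maximal order $n_x$ of a rotation axis of the local group $S_x(2R)$ does not exceed $6$. Then $X_6$ is a Delone set of type $(r',R')$ for some $r'$ and $R'$ with $r\le r'\le R'=kR$.
   Context: $|x,x'|$ denotes the Euclidean distance between points of $\mathbb{R}^3$, and $d(z,X)=\inf_{x\in X}|z,x|$. Delone set: for real numbers $r,R>0$, a set $X\subset\mathbb{R}^3$ is a Delone set of type $(r,R)$ if (1) every open ball of radius $r$ centered at any point of $\mathbb{R}^3$ contains at most one point of $X$; and (2) every closed ball of radius $R$ centered at any point of $\mathbb{R}^3$ contains at least one point of $X$. A Delone set is a set that is Delone of type $(r,R)$ for some $r,R>0$. A Delone set of type $(r,R)$ is also of type $(r_1,R_1)$ whenever $0<r_1\le r$ and $R_1\ge R$. For a given Delone set $X$, the parameters $(r,R)$ of $X$ are the largest $r$ satisfying (1) and the smallest $R$ satisfying (2); equivalently $2r=\inf_{x\ne x'\in X}|x,x'|$ and $R=\sup_{z\in\mathbb{R}^3}d(z,X)$. Cluster: for $x\in X$ and $\rho\ge 0$, the $\rho$-cluster at $x$ is $C_x(\rho)=X\cap B_x(\rho)$, where $B_x(\rho)$ is the closed ball of radius $\rho$ centered at $x$. Cluster group: $S_x(\rho)=\{s\in \mathrm{Iso}(\mathbb{R}^3):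 s(x)=x,\ s(C_x(\rho))=C_x(\rho)\}$, where $\mathrm{Iso}(\mathbb{R}^3)$ is the group of all isometries of $\mathbb{R}^3$ (orientation-preserving or not). The local group at $x$ is $S_x(2R)$, with $R$ the parameter of $X$; it is a finite group. Rotation axes: an axis of $S_x(2R)$ is a line $\ell$ through $x$ such that $S_x(2R)$ contains a nontrivial (orientation-preserving) rotation about $\ell$; the order of the axis is the order of the (finite cyclic) group of all rotations about $\ell$ belonging to $S_x(2R)$. The number $n_x$ is the maximal order of an axis of $S_x(2R)$, with $n_x=1$ if $S_x(2R)$ contains no nontrivial rotation. *)

theory Defs
  imports "HOL-Analysis.Analysis"
begin

type_synonym point = "real ^ 3"

definition delone_type :: "real \<Rightarrow> real \<Rightarrow> point set \<Rightarrow> bool" where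
  "delone_type r R X \<longleftrightarrow> 0 < r \<and> 0 < R \<and>
     (\<forall>z. \<forall>x \<in> X \<inter> ball z r. \<forall>y \<in> X \<inter> ball z r. x = y) \<and>
     (\<forall>z. X \<inter> cball z R \<noteq> {})"

definition delone :: "point set \<Rightarrow> bool" where
  "delone X \<longleftrightarrow> (\<exists>r R. delone_type r R X)"

text \<open>
  The parameters of a Delone set. The infimum and supremum below are taken in the reals; for a
  Delone set they range over nonempty sets that are bounded below and above, respectively.
\<close>

definition packing_param :: "point set \<Rightarrow> real" where
  "packing_param X = Inf {dist x y | x y. x \<in> X \<and> y \<in> X \<and> x \<noteq> y} / 2"

definition covering_param :: "point set \<Rightarrow> real" where
  "covering_param X = (SUP z. infdist z X)"

definition cluster :: "point set \<Rightarrow> point \<Rightarrow> real \<Rightarrow> point set" where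
  "cluster X x \<rho> = X \<inter> cball x \<rho>"

definition Iso3 :: "(point \<Rightarrow> point) set" where
  "Iso3 = {s. bij s \<and> (\<forall>y z. dist (s y) (s z) = dist y z)}"

definition cluster_group :: "point set \<Rightarrow> point \<Rightarrow> real \<Rightarrow> (point \<Rightarrow> point) set" where
  "cluster_group X x \<rho> = {s \<in> Iso3. s x = x \<and> s ` cluster X x \<rho> = cluster X x \<rho>}"

definition local_group :: "point set \<Rightarrow> point \<Rightarrow> (point \<Rightarrow> point) set" where
  "local_group X x = cluster_group X x (2 * covering_param X)"

definition orientation_preserving :: "(point \<Rightarrow> point) \<Rightarrow> bool" where
  "orientation_preserving s \<longleftrightarrow> rotation_matrix (matrix (\<lambda>v. s v - s 0))"
  \<comment> \<open>meant for isometries \<open>s\<close>, where \<open>v \<mapsto> s v - s 0\<close> is the (orthogonal) linear part\<close>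

definition is_line :: "point set \<Rightarrow> bool" where
  "is_line l \<longleftrightarrow> affine l \<and> aff_dim l = 1"

text \<open>All rotations about the line \<open>l\<close>, the identity (rotation by angle zero) included.\<close>

definition rotations_about :: "point set \<Rightarrow> (point \<Rightarrow> point) set" where
  "rotations_about l = {s \<in> Iso3. orientation_preserving s \<and> (\<forall>y \<in> l. s y = y)}"

definition rotation_axis :: "point set \<Rightarrow> point \<Rightarrow> point set \<Rightarrow> bool" where
  "rotation_axis X x l \<longleftrightarrow> is_line l \<and> x \<in> l \<and>
     (\<exists>s \<in> local_group X x. s \<in> rotations_about l \<and> s \<noteq> id)"

definition axis_order :: "point set \<Rightarrow> point \<Rightarrow> point set \<Rightarrow> nat" where
  "axis_order X x l = card (local_group X x \<inter> rotations_about l)"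

text \<open>
  For a Delone set the local group is finite, so that \<open>card\<close> above is the true group order, and
  the maximum below is over a finite set, nonempty in the \<open>else\<close> branch.
\<close>

definition max_axis_order :: "point set \<Rightarrow> point \<Rightarrow> nat" where
  "max_axis_order X x =
     (if \<not> (\<exists>l. rotation_axis X x l) then 1
      else Max {axis_order X x l | l. rotation_axis X x l})"

definition X6 :: "point set \<Rightarrow> point set" where
  "X6 X = {x \<in> X. max_axis_order X x \<le> 6}"

end

theory Submission
  imports Defs
begin

text \<open>
  Let \<open>x\<close> have an axis of order at least 7 and let \<open>p \<in> X\<close> lie off that axis with
  \<open>dist x p \<le> 2 * R\<close>. Seven rotation angles cannot all be far apart, so some rotation \<open>g\<close> of the
  local group moves \<open>p\<close> by at most \<open>2 * pi / 7 < 9/10\<close> times \<open>dist x p\<close>. Now \<open>p\<close>, \<open>g p\<close> and the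
  preimage of \<open>p\<close> under \<open>g\<close> are three distinct points of \<open>X\<close> on a sphere around \<open>x\<close>, hence not
  collinear, so one of the latter two lies off any given axis through \<open>p\<close>. If \<open>p\<close> again has an
  axis of order at least 7, the step repeats with distances shrunk by the factor \<open>9/10\<close>. Distances
  in \<open>X\<close> are bounded below, so the walk stops at a point of \<open>X6 X\<close>, and by the geometric series
  its length is at most \<open>20 * R\<close>, independently of \<open>r\<close>.
\<close>

section \<open>Finite multiplicative sets on the unit circle\<close>

lemma norm_cis_diff_le: "norm (cis a - cis b) \<le> \<bar>a - b\<bar>"
proof -
  have "cis a - cis b = cis b * (cis (a - b) - 1)"
    by (simp add: algebra_simps cis_mult)
  then have "norm (cis a - cis b) = norm (cis (a - b) - 1)"
    by (simp add: norm_mult)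
  also have "\<dots> = 2 * \<bar>sin ((a - b) / 2)\<bar>"
    using dist_exp_i_1[of "a - b"] by (simp add: cis_conv_exp)
  also have "\<dots> \<le> 2 * \<bar>(a - b) / 2\<bar>"
    using abs_sin_x_le_abs_x[of "(a - b) / 2"] by linarith
  finally show ?thesis by simp
qed

text \<open>Pigeonhole on seven arcs of length \<open>2 * pi / 7\<close>: either an element other
  than 1 lies in an arc adjacent to 1, or at least six elements share the other five arcs, and two
  in the same arc have a quotient near 1.\<close>

lemma unit_circle_group_near_one:
  fixes C :: "complex set"
  assumes fin: "finite C" and card: "card C \<ge> 7"
    and unit: "\<And>z. z \<in> C \<Longrightarrow> norm z = 1"
    and mult: "\<And>z w. z \<in> C \<Longrightarrow> w \<in> C \<Longrightarrow> z * w \<in> C"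
  obtains z where "z \<in> C" "z \<noteq> 1" "norm (z - 1) \<le> 9/10"
proof -
  define f :: "complex \<Rightarrow> int" where "f z = \<lfloor>7 * Arg2pi z / (2 * pi)\<rfloor>" for z
  have cis: "z = cis (Arg2pi z)" if "z \<in> C" for z
    using complex_norm_eq_1_exp[of z] unit[OF that] by (simp add: cis_conv_exp)
  \<comment> \<open>This is where order 7 enters: the shortest nontrivial chord of a group of order
    6 has length 1, which would give no contraction.\<close>
  have pi: "2 * pi / 7 \<le> 9/10"
    using pi_approx(2) by simp
  have f_bounds: "of_int (f z) * (2 * pi / 7) \<le> Arg2pi z" "Arg2pi z < (of_int (f z) + 1) * (2 * pi / 7)" for z
  proof -
    have "of_int (f z) \<le> 7 * Arg2pi z / (2 * pi)" "7 * Arg2pi z / (2 * pi) < of_int (f z) + 1"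
      unfolding f_def by linarith+
    then show "of_int (f z) * (2 * pi / 7) \<le> Arg2pi z" "Arg2pi z < (of_int (f z) + 1) * (2 * pi / 7)"
      by (simp_all add: field_simps)
  qed
  have f_range: "f z \<in> {0..6}" for z
  proof -
    have "0 \<le> 7 * Arg2pi z / (2 * pi)" "7 * Arg2pi z / (2 * pi) < 7"
      using Arg2pi[of z] by (simp_all add: field_simps)
    then show ?thesis unfolding f_def by (simp add: floor_less_iff)
  qed
  show thesis
  proof (cases "\<exists>z\<in>C - {1}. f z \<in> {0, 6}")
    case True
    then obtain z where z: "z \<in> C" "z \<noteq> 1" and "f z = 0 \<or> f z = 6" by auto
    \<comment> \<open>Arc 0 begins at angle 0 and arc 6 ends at angle \<open>2 * pi\<close>; both
      ends are the number 1.\<close>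
    then have "\<bar>Arg2pi z - 0\<bar> \<le> 2 * pi / 7 \<or> \<bar>Arg2pi z - 2 * pi\<bar> \<le> 2 * pi / 7"
      using f_bounds[of z] Arg2pi[of z] by auto
    then have "norm (cis (Arg2pi z) - 1) \<le> 2 * pi / 7"
      using norm_cis_diff_le[of "Arg2pi z" 0] norm_cis_diff_le[of "Arg2pi z" "2 * pi"] by auto
    then show thesis using that[of z] z cis[of z] pi by auto
  next
    case False
    then have "f z \<in> {1..5}" if "z \<in> C - {1}" for z
      using f_range[of z] that by (force simp: order_le_less)
    then have "f ` (C - {1}) \<subseteq> {1..5}" by blast
    then have "card (f ` (C - {1})) \<le> 5"
      using card_mono[of "{1..5::int}"] by fastforce
    moreover have "card (C - {1}) \<ge> 6"
      using card card_Diff1_le[of C 1] by (cases "1 \<in> C") (auto simp: card_Diff_singleton_if)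
    ultimately have "\<not> inj_on f (C - {1})"
      by (intro pigeonhole) linarith
    then obtain v w where vw: "v \<in> C" "w \<in> C" "v \<noteq> w" "f v = f w"
      by (auto simp: inj_on_def)
    have "v \<noteq> 0" using unit[OF vw(1)] by auto
    \<comment> \<open>An injective self-map of a finite set is onto; this puts the quotient of
      \<open>w\<close> by \<open>v\<close> into \<open>C\<close>.\<close>
    then have "(*) v ` C = C"
      using endo_inj_surj[OF fin, of "(*) v"] mult vw(1) by (auto simp: inj_on_def)
    then obtain z where z: "z \<in> C" "w = v * z" using vw(2) by auto
    have "norm (z - 1) = norm (w - v)"
      using unit[OF vw(1)] z by (metis mult.right_neutral mult_1 norm_mult right_diff_distrib)
    also have "\<dots> \<le> \<bar>Arg2pi w - Arg2pi v\<bar>"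
      using norm_cis_diff_le cis vw by metis
    also have "\<dots> \<le> 2 * pi / 7"
      using f_bounds[of v] f_bounds[of w] unfolding vw(4) distrib_right abs_le_iff by linarith
    finally show thesis using that[of z] z vw(3) pi by auto
  qed
qed

section \<open>Rotations about a line in an orthonormal frame\<close>

unbundle cross3_syntax

lemma orthonormal_cross_frame:
  fixes u e :: "real ^ 3"
  assumes "norm u = 1" "norm e = 1" "u \<bullet> e = 0"
  shows "(u \<times> e) \<bullet> (u \<times> e) = 1" "u \<times> (u \<times> e) = - e"
    and orthonormal_cross_expansion:
      "v = (v \<bullet> u) *\<^sub>R u + (v \<bullet> e) *\<^sub>R e + (v \<bullet> (u \<times> e)) *\<^sub>R (u \<times> e)"
proof -
  have uu: "u \<bullet> u = 1" "e \<bullet> e = 1" using assms by (simp_all add: norm_eq_1)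
  show m: "(u \<times> e) \<bullet> (u \<times> e) = 1"
    using assms uu by (simp add: dot_cross inner_commute)
  show "u \<times> (u \<times> e) = - e"
    using assms uu by (simp add: Lagrange)
  define d where "d = v - ((v \<bullet> u) *\<^sub>R u + (v \<bullet> e) *\<^sub>R e + (v \<bullet> (u \<times> e)) *\<^sub>R (u \<times> e))"
  have "d \<bullet> u = 0" "d \<bullet> e = 0" "d \<bullet> (u \<times> e) = 0"
    unfolding d_def using uu m assms(3)
    by (simp_all add: inner_diff_left inner_add_left dot_cross_self inner_commute[of e u])
  \<comment> \<open>Lagrange's formula writes \<open>d \<times> (u \<times> e)\<close> as a
    combination of \<open>u\<close> and \<open>e\<close> whose coefficients are inner products of
    \<open>d\<close> with \<open>e\<close> and \<open>u\<close>. A vector whose inner and cross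
    products with a nonzero vector both vanish is zero.\<close>
  then have "d \<bullet> (u \<times> e) = 0 \<and> d \<times> (u \<times> e) = 0"
    by (simp add: Lagrange)
  then have "d = 0" using m by (subst (asm) norm_and_cross_eq_0) auto
  then show "v = (v \<bullet> u) *\<^sub>R u + (v \<bullet> e) *\<^sub>R e + (v \<bullet> (u \<times> e)) *\<^sub>R (u \<times> e)"
    unfolding d_def by simp
qed

lemma Iso3_linear_part:
  assumes "s \<in> Iso3"
  shows "orthogonal_transformation (\<lambda>v. s v - s 0)"
  using assms by (auto simp: orthogonal_transformation_isometry Iso3_def dist_norm)

lemma Iso3_comp: "s \<in> Iso3 \<Longrightarrow> t \<in> Iso3 \<Longrightarrow> s \<circ> t \<in> Iso3"
  unfolding Iso3_def by (auto intro: bij_comp)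

text \<open>Linear parts compose, so their matrices multiply and the determinant remains 1.\<close>

lemma orientation_preserving_comp:
  assumes "s \<in> Iso3" "t \<in> Iso3" "orientation_preserving s" "orientation_preserving t"
  shows "orientation_preserving (s \<circ> t)"
proof -
  let ?S = "\<lambda>v. s v - s 0" and ?T = "\<lambda>v. t v - t 0"
  have lin: "linear ?S" "linear ?T"
    using assms Iso3_linear_part orthogonal_transformation_linear by blast+
  have "(\<lambda>v. (s \<circ> t) v - (s \<circ> t) 0) = ?S \<circ> ?T"
    using linear_diff[OF lin(1)] by (auto simp: fun_eq_iff)
  then have "matrix (\<lambda>v. (s \<circ> t) v - (s \<circ> t) 0) = matrix ?S ** matrix ?T"
    using matrix_compose[OF lin(2,1)] by simp
  then show ?thesis
    using assms(3,4) unfolding orientation_preserving_def rotation_matrix_def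
    by (simp add: det_mul orthogonal_matrix_mul)
qed

lemma rotations_about_comp:
  "s \<in> rotations_about l \<Longrightarrow> t \<in> rotations_about l \<Longrightarrow> s \<circ> t \<in> rotations_about l"
  unfolding rotations_about_def by (auto intro: Iso3_comp orientation_preserving_comp)

text \<open>With respect to the positively oriented orthonormal frame \<open>e\<close>, \<open>u \<times> e\<close>, \<open>u\<close>, this complex
  number is \<open>cis\<close> of the angle of the rotation \<open>s\<close> about the line through \<open>x\<close> in direction \<open>u\<close>.\<close>

definition rotation_number :: "point \<Rightarrow> point \<Rightarrow> point \<Rightarrow> (point \<Rightarrow> point) \<Rightarrow> complex" where
  "rotation_number x u e s = Complex ((s (x + e) - x) \<bullet> e) ((s (x + e) - x) \<bullet> (u \<times> e))"

context
  fixes x u e :: point and l :: "point set"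
  assumes u: "norm u = 1" and e: "norm e = 1" and ue: "u \<bullet> e = 0"
    and xl: "x \<in> l" and xul: "x + u \<in> l"
begin

private abbreviation "c \<equiv> rotation_number x u e"
private abbreviation "m \<equiv> u \<times> e"

text \<open>The linear part \<open>f\<close> fixes \<open>u\<close> and, having determinant 1,
  preserves cross products as well as inner products. Hence \<open>f e\<close> stays orthogonal to
  \<open>u\<close>, and \<open>m\<close> goes to \<open>u \<times> f e\<close>, so the two
  coordinates of \<open>f e\<close> determine the whole rotation.\<close>

lemma
  assumes s: "s \<in> rotations_about l"
  shows rotation_formula: "s (x + v) = x + (v \<bullet> u) *\<^sub>R u + (v \<bullet> e) *\<^sub>R (Re (c s) *\<^sub>R e + Im (c s) *\<^sub>R m)
           + (v \<bullet> m) *\<^sub>R (Re (c s) *\<^sub>R m - Im (c s) *\<^sub>R e)"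
    and norm_rotation_number: "norm (c s) = 1"
proof -
  define f where "f = (\<lambda>v. s v - s 0)"
  have orth: "orthogonal_transformation f" and rot: "rotation_matrix (matrix f)"
    using s Iso3_linear_part unfolding rotations_about_def orientation_preserving_def f_def by auto
  then have lin: "linear f" by (simp add: orthogonal_transformation_linear)
  have inner: "f v \<bullet> f w = v \<bullet> w" for v w
    using orth by (simp add: orthogonal_transformation_def)
  have cross: "f (v \<times> w) = f v \<times> f w" for v w
    using cross_rotation_matrix[OF rot, of v w] lin by (simp add: matrix_works)
  have sx: "s x = x" "s (x + u) = x + u"
    using s xl xul unfolding rotations_about_def by auto
  have sf: "s (x + v) = x + f v" for v
    using linear_add[OF lin, of x v] sx(1) unfolding f_def by (simp add: algebra_simps)
  have fu: "f u = u" using sx(2) sf[of u] by simp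
  have c: "Re (c s) = f e \<bullet> e" "Im (c s) = f e \<bullet> m"
    by (simp_all add: rotation_number_def sf)
  have "f e \<bullet> u = 0" using inner[of e u] fu ue by (simp add: inner_commute)
  then have fe: "f e = Re (c s) *\<^sub>R e + Im (c s) *\<^sub>R m"
    using orthonormal_cross_expansion[OF u e ue, of "f e"] c by simp
  have fm: "f m = Re (c s) *\<^sub>R m - Im (c s) *\<^sub>R e"
    using cross[of u e] fu orthonormal_cross_frame(2)[OF u e ue]
    by (simp add: fe cross_add_right cross_mult_right)
  have "f v = (v \<bullet> u) *\<^sub>R f u + (v \<bullet> e) *\<^sub>R f e + (v \<bullet> m) *\<^sub>R f m"
    by (subst orthonormal_cross_expansion[OF u e ue, of v])
      (simp only: linear_add[OF lin] linear_scale[OF lin])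
  then show "s (x + v) = x + (v \<bullet> u) *\<^sub>R u + (v \<bullet> e) *\<^sub>R (Re (c s) *\<^sub>R e + Im (c s) *\<^sub>R m)
           + (v \<bullet> m) *\<^sub>R (Re (c s) *\<^sub>R m - Im (c s) *\<^sub>R e)"
    by (simp add: sf fu fe fm)
  have "f e \<bullet> f e = (Re (c s))\<^sup>2 + (Im (c s))\<^sup>2"
    using orthonormal_cross_frame(1)[OF u e ue] e
    by (simp add: fe inner_add_left inner_add_right dot_cross_self power2_eq_square norm_eq_1)
  then show "norm (c s) = 1" using inner[of e e] e by (simp add: cmod_def norm_eq_1)
qed

lemma rotation_formula_plane:
  assumes "s \<in> rotations_about l"
  shows "s (x + h *\<^sub>R u + \<rho> *\<^sub>R e) = x + h *\<^sub>R u + \<rho> *\<^sub>R (Re (c s) *\<^sub>R e + Im (c s) *\<^sub>R m)"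
  using rotation_formula[OF assms, where v = "h *\<^sub>R u + \<rho> *\<^sub>R e"] u e ue
  by (simp add: inner_add_left dot_cross_self inner_commute[of e u] norm_eq_1 add.assoc)

lemma inj_on_rotation_number: "inj_on c (rotations_about l)"
proof (rule inj_onI, rule ext)
  fix s t v assume "s \<in> rotations_about l" "t \<in> rotations_about l" "c s = c t"
  then show "s v = t v"
    using rotation_formula[of s, where v = "v - x"] rotation_formula[of t, where v = "v - x"] by simp
qed

text \<open>Together with injectivity, this turns a set of rotations about \<open>l\<close> closed
  under composition into an equally large set of unit complex numbers closed under
  multiplication.\<close>

lemma rotation_number_comp:
  assumes s: "s \<in> rotations_about l" and t: "t \<in> rotations_about l"
  shows "c (s \<circ> t) = c s * c t"
proof -
  have m: "m \<bullet> m = 1" "e \<bullet> e = 1" "m \<bullet> u = 0" "m \<bullet> e = 0" "e \<bullet> m = 0"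
    using orthonormal_cross_frame(1)[OF u e ue] e by (simp_all add: norm_eq_1 dot_cross_self)
  have eu: "e \<bullet> u = 0" using ue by (simp add: inner_commute)
  have t1: "t (x + e) = x + (Re (c t) *\<^sub>R e + Im (c t) *\<^sub>R m)"
    using rotation_formula_plane[OF t, of 0 1] by simp
  show ?thesis
    unfolding rotation_number_def[of x u e "s \<circ> t"]
    by (simp add: t1 rotation_formula[OF s] m eu inner_add_left inner_diff_left complex_eq_iff)
qed

end

section \<open>Lines and the motion of points off an axis\<close>

lemma is_line_eq_range:
  assumes "is_line l" "x \<in> l"
  obtains u where "norm u = 1" "l = range (\<lambda>t. x + t *\<^sub>R u)"
proof -
  have "\<not> l \<subseteq> {x}"
    using assms aff_dim_subset[of l "{x}"] by (auto simp: is_line_def)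
  then obtain y where y: "y \<in> l" "y \<noteq> x" by auto
  have "affine hull {x, y} = l"
  proof (rule affine_dim_equal)
    show "affine hull {x, y} \<subseteq> l"
      using assms y by (intro hull_minimal) (auto simp: is_line_def)
  qed (use assms y in \<open>auto simp: is_line_def aff_dim_2\<close>)
  then have l: "l = range (\<lambda>t. x + t *\<^sub>R (y - x))"
    using affine_hull_2_alt[of x y] by simp
  define n where "n = norm (y - x)"
  have n: "n > 0" using y by (simp add: n_def)
  have "x + t *\<^sub>R (y - x) \<in> range (\<lambda>t. x + t *\<^sub>R ((1 / n) *\<^sub>R (y - x)))" for t
    using n by (intro image_eqI[of _ _ "t * n"]) auto
  then have "l = range (\<lambda>t. x + t *\<^sub>R ((1 / n) *\<^sub>R (y - x)))"
    unfolding l by auto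
  moreover have "norm ((1 / n) *\<^sub>R (y - x)) = 1" using n by (simp add: n_def)
  ultimately show thesis using that by blast
qed

text \<open>Cylindrical coordinates of \<open>p\<close>: \<open>h\<close> is the height along the
  line, and \<open>\<rho>\<close> is the distance from it, bounded by Pythagoras.\<close>

lemma off_line_frame:
  assumes "is_line l" "x \<in> l" "p \<notin> l"
  obtains u e h \<rho> where "norm u = 1" "norm e = 1" "u \<bullet> e = 0" "x + u \<in> l"
    "p = x + h *\<^sub>R u + \<rho> *\<^sub>R e" "0 < \<rho>" "\<rho> \<le> dist x p"
proof -
  obtain u where u: "norm u = 1" and l: "l = range (\<lambda>t. x + t *\<^sub>R u)"
    using is_line_eq_range assms by blast
  have uu: "u \<bullet> u = 1" using u by (simp add: norm_eq_1)
  define h where "h = (p - x) \<bullet> u"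
  define w where "w = p - x - h *\<^sub>R u"
  have p: "p = x + h *\<^sub>R u + w" by (simp add: w_def)
  have "w \<noteq> 0" using p assms(3) l by auto
  have uw: "u \<bullet> w = 0" using uu by (simp add: w_def h_def inner_diff_right inner_commute)
  have "(norm (p - x))\<^sup>2 = h\<^sup>2 + (norm w)\<^sup>2"
    unfolding power2_norm_eq_inner
    by (simp add: p inner_add_left inner_add_right uu uw inner_commute[of w u] power2_eq_square)
  then have "(norm w)\<^sup>2 \<le> (norm (p - x))\<^sup>2" by simp
  then have "norm w \<le> dist x p" by (simp add: dist_norm norm_minus_commute)
  moreover have "x + u \<in> l" unfolding l by (intro image_eqI[of _ _ 1]) auto
  ultimately show thesis
    using that[of u "(1 / norm w) *\<^sub>R w" h "norm w"] u uw p \<open>w \<noteq> 0\<close> by auto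
qed

text \<open>The position of the image on its circle around the axis gives back the rotation number.
  This later embeds an axis group into a finite cluster.\<close>

lemma inj_on_rotations_about_point:
  assumes "is_line l" "p \<notin> l"
  shows "inj_on (\<lambda>s. s p) (rotations_about l)"
proof -
  obtain x where x: "x \<in> l" using assms(1) by (fastforce simp: is_line_def)
  obtain u e h \<rho> where *: "norm u = 1" "norm e = 1" "u \<bullet> e = 0" "x + u \<in> l"
    and p: "p = x + h *\<^sub>R u + \<rho> *\<^sub>R e" and \<rho>: "0 < \<rho>"
    using off_line_frame[OF assms(1) x assms(2)] by metis
  note frame = *(1-3) x *(4)
  have m: "(u \<times> e) \<bullet> (u \<times> e) = 1" "e \<bullet> e = 1"
    using orthonormal_cross_frame(1)[OF *(1-3)] *(2) by (simp_all add: norm_eq_1)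
  show ?thesis
  proof (rule inj_onI)
    fix s t assume st: "s \<in> rotations_about l" "t \<in> rotations_about l" "s p = t p"
    define v where "v s = Re (rotation_number x u e s) *\<^sub>R e + Im (rotation_number x u e s) *\<^sub>R (u \<times> e)" for s
    have "v s = v t"
      using st(3) \<rho> by (simp add: p v_def rotation_formula_plane[OF frame st(1)] rotation_formula_plane[OF frame st(2)])
    then have "v s \<bullet> e = v t \<bullet> e" "v s \<bullet> (u \<times> e) = v t \<bullet> (u \<times> e)" by simp_all
    then have "rotation_number x u e s = rotation_number x u e t"
      by (simp add: v_def inner_add_left m dot_cross_self complex_eq_iff)
    then show "s = t"
      using inj_on_rotation_number[OF frame] st by (simp add: inj_on_def)
  qed
qed

lemma small_rotation:
  assumes l: "is_line l" "x \<in> l" "p \<notin> l"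
    and G: "G \<subseteq> rotations_about l" "finite G" "card G \<ge> 7"
    and comp: "\<And>s t. s \<in> G \<Longrightarrow> t \<in> G \<Longrightarrow> s \<circ> t \<in> G"
  obtains g where "g \<in> G" "g p \<noteq> p" "g (g p) \<noteq> p" "dist (g p) p \<le> 9/10 * dist x p"
proof -
  obtain u e h \<rho> where *: "norm u = 1" "norm e = 1" "u \<bullet> e = 0" "x + u \<in> l"
    and p: "p = x + h *\<^sub>R u + \<rho> *\<^sub>R e" and \<rho>: "0 < \<rho>" "\<rho> \<le> dist x p"
    using off_line_frame[OF l] by metis
  note frame = *(1-3) l(2) *(4)
  define m where "m = u \<times> e"
  have m: "m \<bullet> m = 1" "e \<bullet> e = 1" "e \<bullet> m = 0" "m \<bullet> e = 0"
    using orthonormal_cross_frame(1)[OF *(1-3)] *(2) by (simp_all add: norm_eq_1 m_def dot_cross_self)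
  let ?c = "rotation_number x u e"
  \<comment> \<open>The point moves along a circle of radius \<open>\<rho>\<close>, so its
    displacement is a scaled chord of the unit circle.\<close>
  have moved: "dist (g p) p = \<rho> * norm (?c g - 1)" if "g \<in> rotations_about l" for g
  proof -
    have "g p - p = \<rho> *\<^sub>R ((Re (?c g) - 1) *\<^sub>R e + Im (?c g) *\<^sub>R m)"
      unfolding p rotation_formula_plane[OF frame that] m_def by (simp add: algebra_simps)
    moreover have "norm ((Re (?c g) - 1) *\<^sub>R e + Im (?c g) *\<^sub>R m) = norm (?c g - 1)"
      by (simp add: norm_eq_sqrt_inner[of "_ + _"] cmod_def inner_add_left inner_add_right m power2_eq_square)
    ultimately show ?thesis using \<rho> by (simp add: dist_norm)
  qed
  have inj: "inj_on ?c G" using inj_on_rotation_number[OF frame] G(1) inj_on_subset by blast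
  obtain g where g: "g \<in> G" "?c g \<noteq> 1" "norm (?c g - 1) \<le> 9/10"
  proof (rule unit_circle_group_near_one[of "?c ` G"])
    show "7 \<le> card (?c ` G)" using inj G by (simp add: card_image)
    show "norm z = 1" if "z \<in> ?c ` G" for z using that G(1) norm_rotation_number[OF frame] by auto
    show "z * w \<in> ?c ` G" if "z \<in> ?c ` G" "w \<in> ?c ` G" for z w
    proof -
      from that obtain s t where "s \<in> G" "t \<in> G" "z = ?c s" "w = ?c t" by auto
      then show ?thesis
        using rotation_number_comp[OF frame, of s t] G(1) comp by (metis image_eqI subsetD)
    qed
  qed (use G that in auto)
  have gl: "g \<in> rotations_about l" using g G by auto
  \<comment> \<open>A half-turn has rotation number -1, at distance 2 from 1. Excluding it will
    separate \<open>g p\<close> from the preimage of \<open>p\<close>.\<close>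
  have "g (g p) \<noteq> p"
  proof
    assume "g (g p) = p"
    then have "\<rho> * norm (?c g * ?c g - 1) = 0"
      using moved[OF rotations_about_comp[OF gl gl]] rotation_number_comp[OF frame gl gl] by simp
    then have "?c g * ?c g = 1" using \<rho> by simp
    then have "?c g = -1" using g(2) square_eq_1_iff by auto
    then show False using g(3) by simp
  qed
  moreover have "g p \<noteq> p" using moved[OF gl] g(2) \<rho> by auto
  moreover have "dist (g p) p \<le> 9/10 * dist x p"
    using moved[OF gl] mult_mono[OF \<rho>(2) g(3)] \<rho> by (simp add: mult.commute)
  ultimately show thesis using that g(1) by blast
qed

section \<open>Collinearity\<close>

lemma is_line_imp_collinear: "is_line m \<Longrightarrow> S \<subseteq> m \<Longrightarrow> collinear S"
  using aff_dim_subset[of S m] by (simp add: is_line_def collinear_aff_dim)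

lemma sphere_points_not_collinear:
  fixes x :: point
  assumes "p \<noteq> q" "p \<noteq> q'" "q \<noteq> q'" and "dist x p = dist x q" "dist x p = dist x q'"
  shows "\<not> collinear {p, q, q'}"
proof
  assume "collinear {p, q, q'}"
  then have "aff_dim {p, q, q'} \<le> 1" by (simp add: collinear_aff_dim)
  moreover have "1 \<le> aff_dim {p, q, q'}"
    using aff_dim_subset[of "{p, q}" "{p, q, q'}"] assms(1) by (simp add: aff_dim_2)
  ultimately have "is_line (affine hull {p, q, q'})" by (simp add: is_line_def)
  then obtain v where v: "norm v = 1" "affine hull {p, q, q'} = range (\<lambda>t. p + t *\<^sub>R v)"
    using is_line_eq_range[of _ p] by (metis hull_inc insertI1)
  \<comment> \<open>Besides \<open>p\<close>, a line through \<open>p\<close> has at most one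
    further point on the sphere, since equating squared distances gives
    \<open>t * (2 * (v \<bullet> (p - x)) + t) = 0\<close>.\<close>
  have *: "t = - 2 * (v \<bullet> (p - x))" if "t \<noteq> 0" "dist x p = dist x (p + t *\<^sub>R v)" for t
  proof -
    have vv: "v \<bullet> v = 1" using v by (simp add: norm_eq_1)
    have "(norm (p - x))\<^sup>2 = (norm (p - x + t *\<^sub>R v))\<^sup>2"
      using that(2) by (simp add: dist_norm norm_minus_commute[of x] diff_add_eq)
    also have "\<dots> = (norm (p - x))\<^sup>2 + t * (2 * (v \<bullet> (p - x)) + t)"
      unfolding power2_norm_eq_inner
      by (simp add: inner_add_left inner_add_right vv inner_commute[of "p - x" v] distrib_left)
    finally show ?thesis using that(1) by simp
  qed
  obtain t t' where "q = p + t *\<^sub>R v" "q' = p + t' *\<^sub>R v"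
    using hull_inc[of _ "{p, q, q'}" affine] v(2) by blast
  moreover from this have "t \<noteq> 0" "t' \<noteq> 0" using assms by auto
  ultimately show False using *[of t] *[of t'] assms by metis
qed

section \<open>Packing and covering in Delone sets\<close>

lemma delone_packing:
  assumes "delone X"
  shows "0 < packing_param X"
    and "\<And>x y. x \<in> X \<Longrightarrow> y \<in> X \<Longrightarrow> x \<noteq> y \<Longrightarrow> 2 * packing_param X \<le> dist x y"
proof -
  obtain r R where type: "delone_type r R X" using assms by (auto simp: delone_def)
  let ?S = "{dist x y |x y. x \<in> X \<and> y \<in> X \<and> x \<noteq> y}"
  have sep: "2 * r \<le> dist x y" if "x \<in> X" "y \<in> X" "x \<noteq> y" for x y
  proof (rule ccontr)
    assume "\<not> 2 * r \<le> dist x y"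
    then have "x \<in> ball (midpoint x y) r" "y \<in> ball (midpoint x y) r"
      by (auto simp: dist_midpoint)
    then show False using type that unfolding delone_type_def by blast
  qed
  obtain a where a: "a \<in> X" using type unfolding delone_type_def by blast
  \<comment> \<open>Covering a centre too far from \<open>a\<close> yields a second point of
    \<open>X\<close>, so the set of distances is nonempty and \<open>Inf\<close> is a true
    infimum.\<close>
  obtain b :: point where b: "dist a b = R + 1"
    using type vector_choose_dist[of "R + 1" a] unfolding delone_type_def by auto
  have "X \<inter> cball b R \<noteq> {}" using type unfolding delone_type_def by blast
  then obtain c where c: "c \<in> X" "dist b c \<le> R" by auto
  have "a \<noteq> c" using b c by (auto simp: dist_commute)
  then have ne: "?S \<noteq> {}" using a c by blast
  have "2 * r \<le> Inf ?S" using ne sep by (intro cInf_greatest) auto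
  then show "0 < packing_param X"
    using type unfolding packing_param_def delone_type_def by auto
  show "2 * packing_param X \<le> dist x y" if "x \<in> X" "y \<in> X" "x \<noteq> y" for x y
  proof -
    have "Inf ?S \<le> dist x y"
      using that by (intro cInf_lower bdd_belowI[of _ 0]) auto
    then show ?thesis by (simp add: packing_param_def)
  qed
qed

lemma delone_uniform_discrete: "delone X \<Longrightarrow> uniform_discrete X"
  using delone_packing[of X] by (intro uniformI2[of "2 * packing_param X"]) auto

lemma finite_cluster:
  assumes "delone X"
  shows "finite (cluster X x \<rho>)"
proof -
  have "uniform_discrete (cluster X x \<rho>)"
    using delone_uniform_discrete[OF assms] unfolding uniform_discrete_def cluster_def by blast
  moreover have "bounded (cluster X x \<rho>)"
    unfolding cluster_def by (simp add: bounded_Int)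
  ultimately show ?thesis using uniform_discrete_finite_iff by blast
qed

lemma delone_covering:
  assumes "delone X"
  shows "X \<inter> cball z (covering_param X) \<noteq> {}" and "0 < covering_param X"
proof -
  obtain r R where type: "delone_type r R X" using assms by (auto simp: delone_def)
  \<comment> \<open>Closedness makes the distance from \<open>z\<close> to \<open>X\<close>
    attained, so closed balls of the supremal radius already meet \<open>X\<close>.\<close>
  have clo: "closed X"
    using delone_packing[OF assms]
    by (intro discrete_imp_closed[of "2 * packing_param X"]) (auto simp: not_less[symmetric])
  have ne: "X \<noteq> {}" using type unfolding delone_type_def by auto
  have "infdist z X \<le> R" for z
  proof -
    have "X \<inter> cball z R \<noteq> {}" using type unfolding delone_type_def by blast
    then show ?thesis by (auto intro: infdist_le2)
  qed
  then have bdd: "bdd_above (range (\<lambda>z. infdist z X))" unfolding bdd_above_def by blast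
  have cover: "X \<inter> cball z (covering_param X) \<noteq> {}" for z
  proof -
    obtain x where "x \<in> X" "infdist z X = dist z x"
      using infdist_attains_inf[OF clo ne] by blast
    then show ?thesis
      using cSUP_upper[OF UNIV_I bdd, of z] by (auto simp: covering_param_def)
  qed
  then show "X \<inter> cball z (covering_param X) \<noteq> {}" .
  show "0 < covering_param X"
  proof (rule ccontr)
    assume "\<not> 0 < covering_param X"
    \<comment> \<open>A nonpositive covering radius would make \<open>X\<close> all of space,
      contrary to the positive separation.\<close>
    have "z \<in> X" for z
    proof -
      obtain x where x: "x \<in> X" "dist z x \<le> covering_param X" using cover[of z] by auto
      then have "dist z x \<le> 0" using \<open>\<not> 0 < covering_param X\<close> by linarith
      then show ?thesis using x by simp
    qed
    then have "X = UNIV" by blast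
    then obtain b :: point where "dist 0 b = packing_param X"
      using delone_packing(1)[OF assms] vector_choose_dist[of "packing_param X" 0] by auto
    moreover from this have "0 \<noteq> b" using delone_packing(1)[OF assms] by auto
    ultimately show False
      using delone_packing(1)[OF assms] delone_packing(2)[OF assms, of 0 b] \<open>X = UNIV\<close> by auto
  qed
qed

text \<open>Otherwise finiteness of clusters gives a margin \<open>\<epsilon>\<close> beyond
  \<open>2 * ?R\<close> that is also free of points off \<open>l\<close>. A ball of radius
  \<open>?R\<close> that avoids \<open>l\<close> but stays within this margin then misses
  \<open>X\<close>.\<close>

lemma exists_off_line_point:
  assumes X: "delone X" and l: "is_line l" "x \<in> l"
  obtains p where "p \<in> X" "p \<notin> l" "dist x p \<le> 2 * covering_param X"
proof (rule ccontr)
  let ?R = "covering_param X"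
  note found = that
  assume "\<not> thesis"
  then have far: "2 * ?R < dist x p" if "p \<in> X" "p \<notin> l" for p
    using that found[of p] by force
  define S where "S = dist x ` (cluster X x (2 * ?R + 1) - l)"
  have finS: "finite S" unfolding S_def using finite_cluster[OF X] by blast
  \<comment> \<open>The inserted value keeps the minimum defined when \<open>S\<close> is empty and
    accounts for the points outside the larger cluster.\<close>
  define \<epsilon> where "\<epsilon> = Min (insert (2 * ?R + 1) S) - 2 * ?R"
  have \<epsilon>: "0 < \<epsilon>" using finS far by (auto simp: \<epsilon>_def S_def cluster_def)
  have far': "2 * ?R + \<epsilon> \<le> dist x p" if "p \<in> X" "p \<notin> l" for p
  proof (cases "dist x p \<le> 2 * ?R + 1")
    case True
    then have "dist x p \<in> insert (2 * ?R + 1) S" using that by (auto simp: S_def cluster_def)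
    then show ?thesis unfolding \<epsilon>_def using finS by (simp add: Min_le)
  next
    case False
    moreover have "Min (insert (2 * ?R + 1) S) \<le> 2 * ?R + 1" using finS by (intro Min_le) auto
    ultimately show ?thesis unfolding \<epsilon>_def by linarith
  qed
  obtain u where u: "norm u = 1" "l = range (\<lambda>t. x + t *\<^sub>R u)"
    using is_line_eq_range l by blast
  obtain v where v: "v \<noteq> 0" "orthogonal u v"
    using orthogonal_to_vector_exists[of u] by auto
  define e where "e = (1 / norm v) *\<^sub>R v"
  have e: "norm e = 1" "e \<bullet> u = 0" using v by (auto simp: e_def orthogonal_def inner_commute)
  \<comment> \<open>Moving perpendicularly by slightly more than \<open>?R\<close> leaves
    \<open>l\<close> outside the closed ball around \<open>z\<close>, while that ball stays within
    \<open>2 * ?R + \<epsilon> / 2\<close> of \<open>x\<close>.\<close>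
  define z where "z = x + (?R + \<epsilon> / 2) *\<^sub>R e"
  obtain p where p: "p \<in> X" "dist z p \<le> ?R" using delone_covering(1)[OF X, of z] by auto
  have "p \<notin> l"
  proof
    assume "p \<in> l"
    then obtain t where "p = x + t *\<^sub>R u" using u by auto
    then have "(z - p) \<bullet> e = ?R + \<epsilon> / 2"
      using e by (simp add: z_def inner_diff_left inner_add_left inner_commute[of u] norm_eq_1)
    moreover have "(z - p) \<bullet> e \<le> dist z p"
      using norm_cauchy_schwarz[of "z - p" e] e by (simp add: dist_norm)
    ultimately show False using p \<epsilon> by simp
  qed
  moreover have "dist x z = ?R + \<epsilon> / 2"
    using e delone_covering(2)[OF X] \<epsilon> by (simp add: z_def dist_norm)
  ultimately show False
    using far'[of p] p dist_triangle[of x p z] \<epsilon> by simp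
qed

section \<open>Axis groups and their orders\<close>

text \<open>Evaluation at an off-axis point of the cluster is injective on the axis group and has
  values in the cluster. The bound does not depend on \<open>l\<close>, so the orders of all axes
  through \<open>x\<close> form a finite set.\<close>

lemma finite_axis_group:
  assumes X: "delone X" and l: "is_line l" "x \<in> l"
  shows "finite (local_group X x \<inter> rotations_about l)"
    and "axis_order X x l \<le> card (cluster X x (2 * covering_param X))"
proof -
  let ?C = "cluster X x (2 * covering_param X)" and ?G = "local_group X x \<inter> rotations_about l"
  obtain p where p: "p \<in> X" "p \<notin> l" "dist x p \<le> 2 * covering_param X"
    using exists_off_line_point[OF assms] .
  have inj: "inj_on (\<lambda>s. s p) ?G"
    using inj_on_rotations_about_point[OF l(1) p(2)] inj_on_subset by blast
  have "p \<in> ?C" using p by (simp add: cluster_def)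
  then have sub: "(\<lambda>s. s p) ` ?G \<subseteq> ?C"
    unfolding local_group_def cluster_group_def by blast
  show "finite ?G" using inj_on_finite[OF inj sub finite_cluster[OF X]] .
  show "axis_order X x l \<le> card ?C"
    unfolding axis_order_def using card_inj_on_le[OF inj sub finite_cluster[OF X]] .
qed

text \<open>Since finitely many orders occur, the maximum is attained by an actual axis; the default
  value 1 rules out the case without axes.\<close>

lemma high_order_axis:
  assumes X: "delone X" and x: "x \<in> X" "x \<notin> X6 X"
  obtains l where "is_line l" "x \<in> l" "7 \<le> axis_order X x l"
proof -
  let ?O = "{axis_order X x l |l. rotation_axis X x l}"
  have "?O \<subseteq> {..card (cluster X x (2 * covering_param X))}"
    using finite_axis_group(2)[OF X] by (auto simp: rotation_axis_def)
  then have fin: "finite ?O" using finite_subset by blast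
  have max: "\<not> max_axis_order X x \<le> 6" using x by (simp add: X6_def)
  then have ex: "\<exists>l. rotation_axis X x l" by (auto simp: max_axis_order_def split: if_splits)
  then have "max_axis_order X x \<in> ?O"
    using Min_in[of ?O] Max_in[OF fin] unfolding max_axis_order_def by auto
  then show thesis using max that by (auto simp: rotation_axis_def)
qed

lemma local_group_comp:
  assumes "s \<in> local_group X x" "t \<in> local_group X x"
  shows "s \<circ> t \<in> local_group X x"
proof -
  let ?C = "cluster X x (2 * covering_param X)"
  have st: "s \<in> Iso3" "t \<in> Iso3" "s x = x" "t x = x" "s ` ?C = ?C" "t ` ?C = ?C"
    using assms unfolding local_group_def cluster_group_def by blast+
  then have "(s \<circ> t) ` ?C = ?C" by (metis image_comp)
  then show ?thesis unfolding local_group_def cluster_group_def using st Iso3_comp by fastforce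
qed

section \<open>The shrinking walk\<close>

text \<open>The witnesses are the image and the preimage of \<open>p\<close> under a small rotation.
  The axis is fixed before \<open>p\<close>, because the walk chooses its next point only once the
  axis is known.\<close>

lemma shrinking_step:
  assumes X: "delone X" and x: "x \<in> X" "x \<notin> X6 X"
  obtains l where "is_line l" "x \<in> l"
    "\<And>p. p \<in> X \<Longrightarrow> p \<notin> l \<Longrightarrow> dist x p \<le> 2 * covering_param X \<Longrightarrow>
       \<exists>q\<in>X. \<exists>q'\<in>X. dist p q \<le> 9/10 * dist x p \<and> dist p q' \<le> 9/10 * dist x p \<and>
         \<not> collinear {p, q, q'}"
proof -
  let ?C = "cluster X x (2 * covering_param X)"
  obtain l where l: "is_line l" "x \<in> l" and order: "7 \<le> axis_order X x l"
    using high_order_axis[OF assms] .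
  let ?G = "local_group X x \<inter> rotations_about l"
  show thesis
  proof (rule that[OF l])
    fix p assume p: "p \<in> X" "p \<notin> l" "dist x p \<le> 2 * covering_param X"
    have comp: "s \<circ> t \<in> ?G" if "s \<in> ?G" "t \<in> ?G" for s t
      using that local_group_comp rotations_about_comp by blast
    obtain g where g: "g \<in> ?G" "g p \<noteq> p" "g (g p) \<noteq> p" "dist (g p) p \<le> 9/10 * dist x p"
      by (rule small_rotation[OF l p(2) _ finite_axis_group(1)[OF X l] order[unfolded axis_order_def] comp])
        auto
    have iso: "dist (g a) (g b) = dist a b" for a b
      using g(1) by (auto simp: local_group_def cluster_group_def Iso3_def)
    have gx: "g x = x" and gC: "g ` ?C = ?C"
      using g(1) by (auto simp: local_group_def cluster_group_def)
    have pC: "p \<in> ?C" using p by (simp add: cluster_def)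
    then have "g p \<in> ?C" using gC by blast
    from pC gC obtain p' where p': "p' \<in> ?C" "g p' = p" by (metis imageE)
    \<comment> \<open>Applying \<open>g\<close> carries \<open>p\<close> and \<open>p'\<close> to
      \<open>g p\<close> and \<open>p\<close>, so the two displacements agree.\<close>
    have "dist p p' \<le> 9/10 * dist x p"
      using iso[of p p'] p' g(4) by (simp add: dist_commute)
    moreover have "\<not> collinear {p, g p, p'}"
    proof (rule sphere_points_not_collinear[of _ _ _ x])
      \<comment> \<open>If \<open>g p\<close> and \<open>p'\<close> coincided, then
        \<open>g (g p)\<close> would be \<open>p\<close>.\<close>
      show "p \<noteq> g p" "p \<noteq> p'" "g p \<noteq> p'" using g(2,3) p'(2) by auto
      show "dist x p = dist x (g p)" "dist x p = dist x p'"
        using iso[of x p] iso[of x p'] gx p'(2) by auto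
    qed
    ultimately show "\<exists>q\<in>X. \<exists>q'\<in>X. dist p q \<le> 9/10 * dist x p \<and> dist p q' \<le> 9/10 * dist x p \<and>
         \<not> collinear {p, q, q'}"
      using g(4) \<open>g p \<in> ?C\<close> p'(1) by (auto simp: cluster_def dist_commute)
  qed
qed

text \<open>\<open>D\<close> bounds the next move and shrinks to \<open>9/10 * D\<close> after it;
  the identity \<open>10 * D = D + 10 * (9/10 * D)\<close> closes the induction. The exponent
  \<open>n\<close> limits the number of moves without entering the distance bound.\<close>

lemma descent:
  assumes X: "delone X"
    and "p \<in> X" "q \<in> X" "q' \<in> X" "dist p q \<le> D" "dist p q' \<le> D" "D \<le> 2 * covering_param X"
    and "\<not> collinear {p, q, q'}"
    and "(9/10) ^ n * D < 2 * packing_param X"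
  shows "\<exists>y\<in>X6 X. dist p y \<le> 10 * D"
  using assms(2-)
proof (induction n arbitrary: p q q' D)
  case n: 0
  \<comment> \<open>One candidate differs from \<open>p\<close> yet lies closer than the separation
    of \<open>X\<close>, a contradiction.\<close>
  have "q \<noteq> p \<or> q' \<noteq> p" using n(7) by auto
  then show ?case
    using delone_packing(2)[OF X, of p q] delone_packing(2)[OF X, of p q'] n by auto
next
  case (Suc n)
  have D: "0 \<le> D" using Suc.prems(4) zero_le_dist order_trans by blast
  show ?case
  proof (cases "p \<in> X6 X")
    case True
    then show ?thesis using D by force
  next
    case False
    then obtain l where l: "is_line l" "p \<in> l" and step: "\<And>w. w \<in> X \<Longrightarrow> w \<notin> l \<Longrightarrow> dist p w \<le> 2 * covering_param X \<Longrightarrow>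
       \<exists>v\<in>X. \<exists>v'\<in>X. dist w v \<le> 9/10 * dist p w \<and> dist w v' \<le> 9/10 * dist p w \<and>
         \<not> collinear {w, v, v'}"
      using shrinking_step[OF X Suc.prems(1)] by blast
    \<comment> \<open>As \<open>p\<close> lies on \<open>l\<close>, having both candidates on
      \<open>l\<close> would make the triple collinear.\<close>
    have "q \<notin> l \<or> q' \<notin> l"
      using is_line_imp_collinear[OF l(1), of "{p, q, q'}"] l(2) Suc.prems(7) by auto
    then obtain w where w: "w \<in> X" "w \<notin> l" "dist p w \<le> D"
      using Suc.prems(2-5) by blast
    then obtain v v' where v: "v \<in> X" "v' \<in> X" "dist w v \<le> 9/10 * dist p w" "dist w v' \<le> 9/10 * dist p w"
      "\<not> collinear {w, v, v'}"
      using step[of w] Suc.prems(6) by fastforce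
    have "\<exists>y\<in>X6 X. dist w y \<le> 10 * (9/10 * D)"
      using v w Suc.prems(6,8) D by (intro Suc.IH[of w v v']) auto
    then obtain y where "y \<in> X6 X" "dist w y \<le> 9 * D" by auto
    then show ?thesis using w(3) dist_triangle[of p y w] by force
  qed
qed

text \<open>The constant is 21 = 1 + 2 + 18: one \<open>?R\<close> to a point \<open>x\<close> of
  \<open>X\<close>, two to an off-axis point \<open>p\<close>, and ten times the next step bound
  \<open>9/5 * ?R\<close> for the rest of the walk.\<close>

lemma X6_covering:
  assumes X: "delone X"
  shows "X6 X \<inter> cball z (21 * covering_param X) \<noteq> {}"
proof -
  let ?R = "covering_param X"
  have R: "0 < ?R" using delone_covering(2)[OF X] .
  obtain x where x: "x \<in> X" "dist z x \<le> ?R" using delone_covering(1)[OF X, of z] by auto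
  have "\<exists>y\<in>X6 X. dist x y \<le> 20 * ?R"
  proof (cases "x \<in> X6 X")
    case True
    then show ?thesis using R by force
  next
    case False
    then obtain l where l: "is_line l" "x \<in> l" and step: "\<And>w. w \<in> X \<Longrightarrow> w \<notin> l \<Longrightarrow> dist x w \<le> 2 * ?R \<Longrightarrow>
       \<exists>v\<in>X. \<exists>v'\<in>X. dist w v \<le> 9/10 * dist x w \<and> dist w v' \<le> 9/10 * dist x w \<and>
         \<not> collinear {w, v, v'}"
      using shrinking_step[OF X x(1)] by blast
    obtain p where p: "p \<in> X" "p \<notin> l" "dist x p \<le> 2 * ?R"
      using exists_off_line_point[OF X l] .
    then obtain q q' where q: "q \<in> X" "q' \<in> X" "dist p q \<le> 9/10 * dist x p" "dist p q' \<le> 9/10 * dist x p"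
      "\<not> collinear {p, q, q'}"
      using step[of p] by fastforce
    \<comment> \<open>The number of moves depends on the packing parameter, but the length of the
      walk does not.\<close>
    obtain n where "(9/10) ^ n < 2 * packing_param X / (9/5 * ?R)"
      using real_arch_pow_inv[of "2 * packing_param X / (9/5 * ?R)" "9/10"] delone_packing(1)[OF X] R
      by auto
    then have "(9/10) ^ n * (9/5 * ?R) < 2 * packing_param X"
      using R by (simp add: field_simps)
    then have "\<exists>y\<in>X6 X. dist p y \<le> 10 * (9/5 * ?R)"
      using p q R by (intro descent[OF X p(1) q(1,2)]) auto
    then obtain y where "y \<in> X6 X" "dist p y \<le> 18 * ?R" by auto
    then show ?thesis using p(3) dist_triangle[of x y p] by force
  qed
  then obtain y where "y \<in> X6 X" "dist x y \<le> 20 * ?R" by auto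
  then show ?thesis using x dist_triangle[of z y x] by force
qed

text \<open>Any line through a point \<open>x\<close> of \<open>X\<close> will do: a point of
  \<open>X\<close> off it within \<open>2 * covering_param X\<close> differs from \<open>x\<close>,
  so its distance to \<open>x\<close> is at least twice the packing parameter.\<close>

lemma packing_le_covering:
  assumes X: "delone X"
  shows "packing_param X \<le> covering_param X"
proof -
  obtain x where x: "x \<in> X" using delone_covering(1)[OF X] by blast
  have line: "is_line (affine hull {x, x + axis 1 1})"
    by (simp add: is_line_def aff_dim_2)
  have xl: "x \<in> affine hull {x, x + axis 1 1}" by (simp add: hull_inc)
  obtain p where "p \<in> X" "p \<notin> affine hull {x, x + axis 1 1}" "dist x p \<le> 2 * covering_param X"
    using exists_off_line_point[OF X line xl] .
  then show ?thesis using delone_packing(2)[OF X x, of p] xl by force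
qed

theorem theorem2p1:
  shows "\<exists>k::real. k > 0 \<and>
    (\<forall>(X :: (real ^ 3) set) r R.
       delone X \<longrightarrow> r = packing_param X \<longrightarrow> R = covering_param X \<longrightarrow>
       (\<exists>r' R'. delone_type r' R' (X6 X) \<and> r \<le> r' \<and> r' \<le> R' \<and> R' = k * R))"
proof (rule exI[of _ 21], intro conjI allI impI)
  fix X :: "(real ^ 3) set" and r R :: real
  assume X: "delone X" and r: "r = packing_param X" and R: "R = covering_param X"
  have R0: "0 < R" using delone_covering(2)[OF X] R by simp
  \<comment> \<open>A subset inherits the separation \<open>2 * r\<close>, so \<open>r\<close>
    itself serves as \<open>r'\<close>.\<close>
  have "x = y" if "x \<in> X6 X \<inter> ball z r" "y \<in> X6 X \<inter> ball z r" for x y z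
  proof (rule ccontr)
    assume "x \<noteq> y"
    then have "2 * r \<le> dist x y"
      using that delone_packing(2)[OF X, of x y] r by (auto simp: X6_def)
    then show False using that dist_triangle[of x y z] by (auto simp: dist_commute)
  qed
  then have "delone_type r (21 * R) (X6 X)"
    using X6_covering[OF X, folded R] delone_packing(1)[OF X, folded r] R0
    unfolding delone_type_def by (auto simp del: Int_iff)
  moreover have "r \<le> 21 * R" using packing_le_covering[OF X] r R R0 by simp
  ultimately show "\<exists>r' R'. delone_type r' R' (X6 X) \<and> r \<le> r' \<and> r' \<le> R' \<and> R' = 21 * R"
    by blast
qed simp

end
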